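(* (i) For every positive integer $k$, the subdivision of the complete graph $K_k$ has Sidorenko's property. (ii) If a graph $H$ has Sidorenko's property, then the subdivision of $H$ also has Sidorenko's property.
   Context: All graphs are finite and simple. $\mathrm{Hom}(H,G)$ is the set of graph homomorphisms from $H$ to $G$. A graph $H$ has Sidorenko's property if for every graph $G$, $|\mathrm{Hom}(H,G)|\ge |V(G)|^{|V(H)|}\left(\frac{2|E(G)|}{|V(G)|^2}\right)^{|E(H)|}$. The subdivision of a graph $H$ is the graph obtained from $H$ by replacing each edge by a path of length two, these paths being internally vertex-disjoint (i.e. each edge receives its own new middle vertex). *)

theory Defs
  imports Complex_Main "HOL-Library.FuncSet"
begin

record 'a ugraph =
  verts :: "'a set"
  edges :: "'a set set"

definition finite_simple_graph :: "'a ugraph \<Rightarrow> bool" where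
  "finite_simple_graph G \<longleftrightarrow>
     finite (verts G) \<and> (\<forall>e \<in> edges G. e \<subseteq> verts G \<and> card e = 2)"

text \<open>Homomorphisms are taken extensional outside \<open>verts H\<close>, so that this set is
  in bijection with the homomorphisms as maps \<open>V(H) \<rightarrow> V(G)\<close> and has the right cardinality.\<close>

definition Hom :: "'a ugraph \<Rightarrow> 'b ugraph \<Rightarrow> ('a \<Rightarrow> 'b) set" where
  "Hom H G =
     {f \<in> verts H \<rightarrow>\<^sub>E verts G. \<forall>u v. {u, v} \<in> edges H \<longrightarrow> {f u, f v} \<in> edges G}"

definition sidorenko_ineq :: "'a ugraph \<Rightarrow> 'b ugraph \<Rightarrow> bool" where
  "sidorenko_ineq H G \<longleftrightarrow>
     real (card (Hom H G)) \<ge>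
       real (card (verts G)) ^ card (verts H) *
       (2 * real (card (edges G)) / (real (card (verts G)))\<^sup>2) ^ card (edges H)"

text \<open>A definition cannot quantify over types, so \<open>G\<close> ranges over the finite simple graphs on
  natural numbers, which represent all isomorphism types; lemma \<open>sidorenko_any_type\<close> below
  gives the inequality for vertices of any type. For \<open>G\<close> without vertices the edge density is
  \<open>0 / 0 = 0\<close>, and the inequality holds trivially (lemma \<open>sidorenko_ineq_no_verts\<close>).\<close>

definition sidorenko :: "'a ugraph \<Rightarrow> bool" where
  "sidorenko H \<longleftrightarrow> (\<forall>G :: nat ugraph. finite_simple_graph G \<longrightarrow> sidorenko_ineq H G)"

text \<open>The middle vertex of the path replacing the edge \<open>e\<close> is \<open>Inr e\<close>.\<close>

definition subdivision :: "'a ugraph \<Rightarrow> ('a + 'a set) ugraph" where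
  "subdivision H =
     \<lparr>verts = Inl ` verts H \<union> Inr ` edges H,
      edges = {{Inl v, Inr e} | v e. e \<in> edges H \<and> v \<in> e}\<rparr>"

definition complete_graph :: "nat \<Rightarrow> nat ugraph" where
  "complete_graph k = \<lparr>verts = {..<k}, edges = {e. e \<subseteq> {..<k} \<and> card e = 2}\<rparr>"

lemma finite_simple_graph_complete_graph: "finite_simple_graph (complete_graph k)"
  by (simp add: finite_simple_graph_def complete_graph_def)

lemma finite_simple_graph_subdivision:
  assumes "finite_simple_graph H"
  shows "finite_simple_graph (subdivision H)"
proof -
  have "edges H \<subseteq> Pow (verts H)" "finite (verts H)"
    using assms by (auto simp: finite_simple_graph_def)
  then have "finite (edges H)"
    by (meson finite_Pow_iff finite_subset)
  then show ?thesis
    using assms by (fastforce simp: finite_simple_graph_def subdivision_def)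
qed

lemma sidorenko_ineq_no_verts:
  assumes "finite_simple_graph H" "verts G = {}"
  shows "sidorenko_ineq H G"
proof (cases "verts H = {}")
  case True
  then have "edges H = {}"
    using assms(1) by (fastforce simp: finite_simple_graph_def)
  with True have "Hom H G = {\<lambda>x. undefined}"
    by (auto simp: Hom_def)
  then show ?thesis
    using True \<open>edges H = {}\<close> by (simp add: sidorenko_ineq_def)
next
  case False
  then have "card (verts H) > 0"
    using assms(1) by (auto simp: finite_simple_graph_def card_gt_0_iff)
  then show ?thesis
    using assms(2) by (simp add: sidorenko_ineq_def power_0_left)
qed

lemma sidorenko_any_type:
  fixes G :: "'b ugraph"
  assumes H: "finite_simple_graph H" "sidorenko H" and G: "finite_simple_graph G"
  shows "sidorenko_ineq H G"
proof -
  have fin: "finite (verts G)" and eG: "\<And>e. e \<in> edges G \<Longrightarrow> e \<subseteq> verts G \<and> card e = 2"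
    using G by (auto simp: finite_simple_graph_def)
  have eH: "\<And>u v. {u, v} \<in> edges H \<Longrightarrow> u \<in> verts H \<and> v \<in> verts H"
    using H(1) by (auto simp: finite_simple_graph_def)
  obtain g :: "'b \<Rightarrow> nat" where g: "inj_on g (verts G)"
    using finite_imp_inj_to_nat_seg[OF fin] by blast
  define G' where "G' = \<lparr>verts = g ` verts G, edges = (\<lambda>e. g ` e) ` edges G\<rparr>"
  have "card (g ` e) = 2" if "e \<in> edges G" for e
    using eG[OF that] g by (metis card_image inj_on_subset)
  then have "finite_simple_graph G'"
    using fin eG by (auto simp: finite_simple_graph_def G'_def)
  then have ineq: "sidorenko_ineq H G'"
    using H(2) by (simp add: sidorenko_def)
  have cv: "card (verts G') = card (verts G)"
    using g by (simp add: G'_def card_image)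
  have "inj_on (\<lambda>e. g ` e) (edges G)"
    using g eG by (meson inj_on_image_eq_iff inj_onI)
  then have ce: "card (edges G') = card (edges G)"
    by (simp add: G'_def card_image)
  define h where "h = inv_into (verts G) g"
  have hg: "h (g x) = x" if "x \<in> verts G" for x
    using g that by (simp add: h_def)
  have "finite (verts H \<rightarrow>\<^sub>E verts G)"
    using H(1) fin by (auto simp: finite_simple_graph_def intro: finite_PiE)
  then have "finite (Hom H G)"
    unfolding Hom_def by (rule rev_finite_subset) auto
  moreover have "Hom H G' \<subseteq> (\<lambda>f. restrict (g \<circ> f) (verts H)) ` Hom H G"
  proof
    fix f assume f: "f \<in> Hom H G'"
    then have fv: "f x \<in> g ` verts G" if "x \<in> verts H" for x
      using that by (auto simp: Hom_def G'_def)
    define f' where "f' = restrict (h \<circ> f) (verts H)"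
    have gh: "g (h y) = y" if "y \<in> g ` verts G" for y
      using that hg by auto
    have "{f' u, f' v} \<in> edges G" if uv: "{u, v} \<in> edges H" for u v
    proof -
      obtain e where e: "e \<in> edges G" "{f u, f v} = g ` e"
        using f uv by (force simp: Hom_def G'_def simp del: image_insert)
      have "h ` g ` e = e"
        using eG[OF e(1)] hg by (force simp: image_iff)
      moreover have "{f' u, f' v} = h ` {f u, f v}"
        using eH[OF uv] by (simp add: f'_def)
      ultimately show ?thesis using e by simp
    qed
    moreover have "f' \<in> verts H \<rightarrow>\<^sub>E verts G"
      using fv hg by (fastforce simp: f'_def)
    ultimately have "f' \<in> Hom H G" by (simp add: Hom_def)
    moreover have "f = restrict (g \<circ> f') (verts H)"
      using f fv gh by (auto simp: f'_def Hom_def fun_eq_iff restrict_def PiE_def extensional_def)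
    ultimately show "f \<in> (\<lambda>f. restrict (g \<circ> f) (verts H)) ` Hom H G" by blast
  qed
  ultimately have "card (Hom H G') \<le> card (Hom H G)"
    by (meson card_image_le card_mono finite_imageI le_trans)
  then show ?thesis
    using ineq by (simp add: sidorenko_ineq_def cv ce)
qed

end

(* Homomorphisms from the subdivision of H to G are counted by the sum over all maps
   f from V(H) to V(G) of the product over the edges uv of H of the codegree of f(u), f(v).

   The codegree matrix is A^2 for the adjacency matrix A, hence the weighted graph it defines is
   dense on every weighted vertex set: u^T A^2 u = |A u|^2. For complete graphs this local density
   gives the bound by induction on the number of vertices.

   For general H, Sidorenko's inequality for H has to be applied to the codegrees as edge weights.
   They are realised by random graphs: in a blow-up of V(G) with N levels, each pair of levels
   chooses a random vertex z of G, and vertices of these levels are joined when z is a common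
   neighbour. The expected number of homomorphisms from H is, up to the maps that are not
   injective on levels, the weighted count, and the inequality follows by taking expectations,
   convexity, and N to infinity. *)
theory Submission imports Defs begin

section \<open>Weighted power means\<close>

text \<open>Chebyshev's sum inequality: nonnegative numbers and their powers are ordered alike, so
  \<open>(s x - s y) * (s x ^ m - s y ^ m)\<close> is nonnegative, and its weighted double sum is
  twice the difference of the two sides.\<close>

lemma weighted_chebyshev_power:
  fixes p s :: "'a \<Rightarrow> real"
  assumes "finite A" "\<And>x. x \<in> A \<Longrightarrow> 0 \<le> p x" "\<And>x. x \<in> A \<Longrightarrow> 0 \<le> s x"
  shows "(\<Sum>x\<in>A. p x * s x) * (\<Sum>x\<in>A. p x * s x ^ m) \<le> (\<Sum>x\<in>A. p x) * (\<Sum>x\<in>A. p x * s x ^ Suc m)"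
proof -
  have mono: "0 \<le> (a - b) * (a ^ m - b ^ m)" if "0 \<le> a" "0 \<le> b" for a b :: real
    using that power_mono[of a b m] power_mono[of b a m]
    by (cases "a \<le> b") (auto simp: mult_nonpos_nonpos)
  have "0 \<le> (\<Sum>x\<in>A. \<Sum>y\<in>A. p x * p y * ((s x - s y) * (s x ^ m - s y ^ m)))"
    by (intro sum_nonneg mult_nonneg_nonneg[OF mult_nonneg_nonneg mono] assms(2,3))
  also have "\<dots> = (\<Sum>x\<in>A. \<Sum>y\<in>A. (p x * s x ^ Suc m) * p y - (p x * s x) * (p y * s y ^ m)
      - (p x * s x ^ m) * (p y * s y) + p x * (p y * s y ^ Suc m))"
    by (intro sum.cong) (simp_all add: algebra_simps)
  also have "\<dots> = 2 * ((\<Sum>x\<in>A. p x) * (\<Sum>x\<in>A. p x * s x ^ Suc m)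
      - (\<Sum>x\<in>A. p x * s x) * (\<Sum>x\<in>A. p x * s x ^ m))"
    unfolding sum.distrib sum_subtractf sum_product[symmetric] by (simp add: algebra_simps)
  finally show ?thesis by simp
qed

text \<open>Jensen's inequality for the power \<open>Suc m\<close>, with denominators cleared so
  that total weight zero is allowed. Each induction step is one use of Chebyshev's
  inequality.\<close>

lemma weighted_power_mean:
  fixes p s :: "'a \<Rightarrow> real"
  assumes "finite A" "\<And>x. x \<in> A \<Longrightarrow> 0 \<le> p x" "\<And>x. x \<in> A \<Longrightarrow> 0 \<le> s x"
  shows "(\<Sum>x\<in>A. p x * s x) ^ Suc m \<le> (\<Sum>x\<in>A. p x) ^ m * (\<Sum>x\<in>A. p x * s x ^ Suc m)"
proof (induction m)
  case 0
  show ?case by simp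
next
  case (Suc m)
  have "(\<Sum>x\<in>A. p x * s x) ^ Suc (Suc m)
      \<le> (\<Sum>x\<in>A. p x * s x) * ((\<Sum>x\<in>A. p x) ^ m * (\<Sum>x\<in>A. p x * s x ^ Suc m))"
    unfolding power_Suc[of _ "Suc m"]
    using assms by (intro mult_left_mono[OF Suc]) (simp add: sum_nonneg)
  also have "\<dots> = (\<Sum>x\<in>A. p x) ^ m * ((\<Sum>x\<in>A. p x * s x) * (\<Sum>x\<in>A. p x * s x ^ Suc m))"
    by (simp add: mult_ac)
  also have "\<dots> \<le> (\<Sum>x\<in>A. p x) ^ m * ((\<Sum>x\<in>A. p x) * (\<Sum>x\<in>A. p x * s x ^ Suc (Suc m)))"
    using assms by (intro mult_left_mono weighted_chebyshev_power zero_le_power sum_nonneg) auto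
  finally show ?case by (simp add: mult_ac)
qed

text \<open>The factor \<open>card A\<close> on the left replaces an exponent \<open>m - 1\<close>
  on the right, so that \<open>m = 0\<close> is covered. That case occurs for \<open>k = 1\<close>
  and for graphs \<open>H\<close> without edges.\<close>

lemma power_mean:
  fixes s :: "'a \<Rightarrow> real"
  assumes "finite A" "\<And>x. x \<in> A \<Longrightarrow> 0 \<le> s x"
  shows "(\<Sum>x\<in>A. s x) ^ m * card A \<le> real (card A) ^ m * (\<Sum>x\<in>A. s x ^ m)"
proof (cases m)
  case (Suc k)
  then show ?thesis
    using mult_right_mono[OF weighted_power_mean[of A "\<lambda>_. 1" s k], of "card A"] assms
    by (simp add: mult_ac)
qed simp

section \<open>Counting homomorphisms\<close>

lemma finite_edges:
  assumes "finite_simple_graph G"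
  shows "finite (edges G)"
  using assms by (auto simp: finite_simple_graph_def intro: finite_subset[of _ "Pow (verts G)"])

lemma edge_pairE:
  assumes "finite_simple_graph G" "e \<in> edges G"
  obtains u v where "e = {u, v}" "u \<noteq> v" "u \<in> verts G" "v \<in> verts G"
proof -
  have "e \<subseteq> verts G" "card e = 2"
    using assms by (simp_all add: finite_simple_graph_def)
  then show thesis
    by (auto simp: card_2_iff intro: that)
qed

lemma Hom_iff:
  assumes "finite_simple_graph H"
  shows "f \<in> Hom H G \<longleftrightarrow> f \<in> verts H \<rightarrow>\<^sub>E verts G \<and> (\<forall>e\<in>edges H. f ` e \<in> edges G)"
proof
  assume f: "f \<in> Hom H G"
  have "f ` e \<in> edges G" if e: "e \<in> edges H" for e
  proof -
    obtain u v where "e = {u, v}"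
      using edge_pairE[OF assms e] by metis
    then show ?thesis
      using f e by (simp add: Hom_def)
  qed
  then show "f \<in> verts H \<rightarrow>\<^sub>E verts G \<and> (\<forall>e\<in>edges H. f ` e \<in> edges G)"
    using f by (auto simp: Hom_def)
next
  assume f: "f \<in> verts H \<rightarrow>\<^sub>E verts G \<and> (\<forall>e\<in>edges H. f ` e \<in> edges G)"
  then have "f ` {u, v} \<in> edges G" if "{u, v} \<in> edges H" for u v
    using that by blast
  with f show "f \<in> Hom H G"
    by (simp add: Hom_def)
qed

text \<open>Taking a set instead of two vertices allows the image of an edge to be inserted even
  when a map identifies its ends; the singleton then yields the degree, which is the diagonal value
  of the codegree.\<close>

definition common_nbrs :: "'a ugraph \<Rightarrow> 'a set \<Rightarrow> 'a set" where
  "common_nbrs G A = {z \<in> verts G. \<forall>a\<in>A. {a, z} \<in> edges G}"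

lemma common_nbrs_subset: "common_nbrs G A \<subseteq> verts G"
  by (auto simp: common_nbrs_def)

lemma finite_common_nbrs: "finite_simple_graph G \<Longrightarrow> finite (common_nbrs G A)"
  by (simp add: common_nbrs_def finite_simple_graph_def)

text \<open>Once the images of the original vertices are fixed by \<open>f\<close>, the middle
  vertices are mapped independently: the one of \<open>e\<close> may go to any common neighbour of
  the image of \<open>e\<close>.\<close>

lemma card_Hom_subdivision:
  assumes H: "finite_simple_graph H" and G: "finite_simple_graph G"
  shows "card (Hom (subdivision H) G)
    = (\<Sum>f\<in>verts H \<rightarrow>\<^sub>E verts G. \<Prod>e\<in>edges H. card (common_nbrs G (f ` e)))"
proof -
  let ?S = "SIGMA f : verts H \<rightarrow>\<^sub>E verts G. \<Pi>\<^sub>E e\<in>edges H. common_nbrs G (f ` e)"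
  \<comment> \<open>\<open>fw\<close> separates the values on original vertices from those on middle
    vertices, and \<open>bk\<close> glues them together again.\<close>
  define fw where "fw h = (\<lambda>v\<in>verts H. h (Inl v), \<lambda>e\<in>edges H. h (Inr e))"
    for h :: "'a + 'a set \<Rightarrow> 'b"
  define bk :: "('a \<Rightarrow> 'b) \<times> ('a set \<Rightarrow> 'b) \<Rightarrow> 'a + 'a set \<Rightarrow> 'b"
    where "bk = (\<lambda>(f, g). \<lambda>x\<in>Inl ` verts H \<union> Inr ` edges H. case_sum f g x)"
  have sub: "v \<in> verts H" if "e \<in> edges H" "v \<in> e" for e v
    using H that by (auto simp: finite_simple_graph_def)
  have hom: "h \<in> Hom (subdivision H) G \<longleftrightarrow> h \<in> Inl ` verts H \<union> Inr ` edges H \<rightarrow>\<^sub>E verts G \<and>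
      (\<forall>e\<in>edges H. \<forall>v\<in>e. {h (Inl v), h (Inr e)} \<in> edges G)" for h
  proof -
    have "edges (subdivision H) = (\<Union>e\<in>edges H. \<Union>v\<in>e. {{Inl v, Inr e}})"
      by (auto simp: subdivision_def)
    then show ?thesis
      unfolding Hom_iff[OF finite_simple_graph_subdivision[OF H]] by (simp add: subdivision_def)
  qed
  have "bij_betw fw (Hom (subdivision H) G) ?S"
  proof (rule bij_betw_byWitness[where f' = bk])
    show "\<forall>h\<in>Hom (subdivision H) G. bk (fw h) = h"
    proof
      fix h
      assume "h \<in> Hom (subdivision H) G"
      then have "h \<in> extensional (Inl ` verts H \<union> Inr ` edges H)"
        by (simp add: hom PiE_iff)
      then show "bk (fw h) = h"
        by (auto simp: bk_def fw_def fun_eq_iff extensional_def)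
    qed
    show "\<forall>fg\<in>?S. fw (bk fg) = fg"
      by (auto simp: bk_def fw_def fun_eq_iff PiE_iff extensional_def)
    show "fw ` Hom (subdivision H) G \<subseteq> ?S"
    proof
      fix y
      assume "y \<in> fw ` Hom (subdivision H) G"
      then obtain h where y: "y = fw h" and h: "h \<in> Hom (subdivision H) G"
        by blast
      then show "y \<in> ?S"
        unfolding hom using sub by (auto simp: y fw_def common_nbrs_def PiE_iff)
    qed
    show "bk ` ?S \<subseteq> Hom (subdivision H) G"
    proof
      fix y
      assume "y \<in> bk ` ?S"
      then obtain f g where y: "y = bk (f, g)" and f: "f \<in> verts H \<rightarrow>\<^sub>E verts G"
        and g: "\<And>e. e \<in> edges H \<Longrightarrow> g e \<in> common_nbrs G (f ` e)"
        by (auto simp: PiE_iff)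
      then show "y \<in> Hom (subdivision H) G"
        using sub unfolding y hom by (auto simp: bk_def common_nbrs_def PiE_iff)
    qed
  qed
  then have "card (Hom (subdivision H) G) = card ?S"
    by (rule bij_betw_same_card)
  also have "\<dots> = (\<Sum>f\<in>verts H \<rightarrow>\<^sub>E verts G. card (\<Pi>\<^sub>E e\<in>edges H. common_nbrs G (f ` e)))"
    using H G finite_edges[OF H] finite_common_nbrs[OF G]
    by (intro card_SigmaI) (auto simp: finite_simple_graph_def intro!: finite_PiE)
  finally show ?thesis
    using finite_edges[OF H] by (simp add: card_PiE)
qed

lemma card_verts_subdivision:
  assumes "finite_simple_graph H"
  shows "card (verts (subdivision H)) = card (verts H) + card (edges H)"
proof -
  have "verts (subdivision H) = verts H <+> edges H"
    by (simp add: subdivision_def Plus_def)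
  then show ?thesis
    using assms finite_edges[OF assms] by (simp add: card_Plus finite_simple_graph_def)
qed

text \<open>The new edges correspond to the incident pairs \<open>(e, v)\<close>, two for each
  \<open>e\<close>.\<close>

lemma card_edges_subdivision:
  assumes "finite_simple_graph H"
  shows "card (edges (subdivision H)) = 2 * card (edges H)"
proof -
  have "edges (subdivision H) = (\<lambda>(e, v). {Inl v, Inr e}) ` (SIGMA e : edges H. e)"
    by (force simp: subdivision_def)
  moreover have "inj_on (\<lambda>(e, v). {Inl v, Inr e}) (SIGMA e : edges H. e)"
    by (auto simp: inj_on_def doubleton_eq_iff)
  moreover have "card (SIGMA e : edges H. e) = (\<Sum>e\<in>edges H. card e)"
    using assms finite_edges[OF assms] unfolding finite_simple_graph_def
    by (intro card_SigmaI) (auto intro: finite_subset)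
  ultimately show ?thesis
    using assms by (simp add: card_image finite_simple_graph_def)
qed

text \<open>Common reduction of both claims to a bound on a sum of products of codegrees. The graph
  without vertices is settled here, so that later divisions by the number of vertices are
  harmless.\<close>

lemma sidorenko_subdivisionI:
  fixes H :: "'a ugraph"
  assumes H: "finite_simple_graph H"
    and ineq: "\<And>G :: nat ugraph. finite_simple_graph G \<Longrightarrow> verts G \<noteq> {} \<Longrightarrow>
      real (card (verts G)) ^ (card (verts H) + card (edges H)) *
        (2 * real (card (edges G)) / (real (card (verts G)))\<^sup>2) ^ (2 * card (edges H))
      \<le> (\<Sum>f\<in>verts H \<rightarrow>\<^sub>E verts G. \<Prod>e\<in>edges H. real (card (common_nbrs G (f ` e))))"
  shows "sidorenko (subdivision H)"
  unfolding sidorenko_def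
proof (intro allI impI)
  fix G :: "nat ugraph"
  assume G: "finite_simple_graph G"
  show "sidorenko_ineq (subdivision H) G"
  proof (cases "verts G = {}")
    case True
    then show ?thesis
      by (intro sidorenko_ineq_no_verts finite_simple_graph_subdivision H)
  next
    case False
    then show ?thesis
      using ineq[OF G]
      by (simp add: sidorenko_ineq_def card_Hom_subdivision[OF H G]
          card_verts_subdivision[OF H] card_edges_subdivision[OF H])
  qed
qed

section \<open>Degrees and codegrees\<close>

abbreviation deg :: "'a ugraph \<Rightarrow> 'a \<Rightarrow> real" where
  "deg G x \<equiv> real (card (common_nbrs G {x}))"

abbreviation codeg :: "'a ugraph \<Rightarrow> 'a \<Rightarrow> 'a \<Rightarrow> real" where
  "codeg G x y \<equiv> real (card (common_nbrs G {x, y}))"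

lemma card_adjacent_pairs:
  assumes G: "finite_simple_graph G"
  shows "card {(x, y). {x, y} \<in> edges G} = 2 * card (edges G)"
proof -
  have two: "card {(x, y). {x, y} = e} = 2" if e: "e \<in> edges G" for e
  proof -
    obtain u v where "e = {u, v}" "u \<noteq> v"
      using edge_pairE[OF G e] by blast
    then have "{(x, y). {x, y} = e} = {(u, v), (v, u)}"
      by (auto simp: doubleton_eq_iff)
    then show ?thesis
      using \<open>u \<noteq> v\<close> by simp
  qed
  have "{(x, y). {x, y} \<in> edges G} = (\<Union>e\<in>edges G. {(x, y). {x, y} = e})"
    by auto
  also have "card \<dots> = (\<Sum>e\<in>edges G. card {(x, y). {x, y} = e})"
  proof (rule card_UN_disjoint)
    show "\<forall>e\<in>edges G. finite {(x, y). {x, y} = e}"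
      using two by (metis card.infinite zero_neq_numeral)
  qed (use finite_edges[OF G] in auto)
  finally show ?thesis
    using two by simp
qed

lemma sum_deg:
  assumes G: "finite_simple_graph G"
  shows "(\<Sum>x\<in>verts G. deg G x) = 2 * real (card (edges G))"
proof -
  have "(SIGMA x : verts G. common_nbrs G {x}) = {(x, y). {x, y} \<in> edges G}"
    using G by (auto simp: common_nbrs_def finite_simple_graph_def)
  moreover have "card (SIGMA x : verts G. common_nbrs G {x}) = (\<Sum>x\<in>verts G. card (common_nbrs G {x}))"
    using G finite_common_nbrs[OF G] by (intro card_SigmaI) (auto simp: finite_simple_graph_def)
  ultimately show ?thesis
    using card_adjacent_pairs[OF G] by (metis of_nat_mult of_nat_numeral of_nat_sum)
qed

lemma deg_eq_sum:
  assumes "finite_simple_graph G"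
  shows "deg G x = (\<Sum>z\<in>verts G. of_bool ({x, z} \<in> edges G))"
  using assms by (simp add: common_nbrs_def finite_simple_graph_def Int_def sum_of_bool_eq)

lemma codeg_eq_sum:
  assumes "finite_simple_graph G"
  shows "codeg G x y = (\<Sum>z\<in>verts G. of_bool ({x, z} \<in> edges G) * of_bool ({y, z} \<in> edges G))"
  using assms
  by (simp add: common_nbrs_def finite_simple_graph_def Int_def sum_of_bool_eq flip: of_bool_conj)

text \<open>With \<open>A\<close> the adjacency matrix the form is the squared norm of \<open>A u\<close>, and the entries of
  \<open>A u\<close> sum fw \<open>\<Sum>x. u x * deg x\<close>: apply Cauchy-Schwarz.\<close>

lemma codeg_form_ge:
  assumes G: "finite_simple_graph G" and u: "\<And>x. x \<in> verts G \<Longrightarrow> 0 \<le> u x"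
  shows "(\<Sum>x\<in>verts G. u x * deg G x)\<^sup>2
    \<le> card (verts G) * (\<Sum>x\<in>verts G. \<Sum>y\<in>verts G. u x * u y * codeg G x y)"
proof -
  let ?V = "verts G" and ?a = "\<lambda>x z. of_bool ({x, z} \<in> edges G) :: real"
  let ?s = "\<lambda>z. \<Sum>x\<in>?V. u x * ?a x z"
  have "(\<Sum>x\<in>?V. u x * deg G x) = (\<Sum>x\<in>?V. \<Sum>z\<in>?V. u x * ?a x z)"
    by (simp only: deg_eq_sum[OF G] sum_distrib_left)
  also have "\<dots> = (\<Sum>z\<in>?V. ?s z)"
    by (rule sum.swap)
  finally have deg: "(\<Sum>x\<in>?V. u x * deg G x) = (\<Sum>z\<in>?V. ?s z)" .
  have "(\<Sum>x\<in>?V. \<Sum>y\<in>?V. u x * u y * codeg G x y)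
      = (\<Sum>x\<in>?V. \<Sum>y\<in>?V. \<Sum>z\<in>?V. (u x * ?a x z) * (u y * ?a y z))"
    by (simp only: codeg_eq_sum[OF G] sum_distrib_left mult_ac)
  also have "\<dots> = (\<Sum>x\<in>?V. \<Sum>z\<in>?V. \<Sum>y\<in>?V. (u x * ?a x z) * (u y * ?a y z))"
    by (intro sum.cong sum.swap refl)
  also have "\<dots> = (\<Sum>z\<in>?V. \<Sum>x\<in>?V. \<Sum>y\<in>?V. (u x * ?a x z) * (u y * ?a y z))"
    by (rule sum.swap)
  also have "\<dots> = (\<Sum>z\<in>?V. (?s z)\<^sup>2)"
    by (simp only: sum_product[symmetric] power2_eq_square)
  finally have codeg: "(\<Sum>x\<in>?V. \<Sum>y\<in>?V. u x * u y * codeg G x y) = (\<Sum>z\<in>?V. (?s z)\<^sup>2)" .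
  \<comment> \<open>Cauchy-Schwarz as the power mean inequality with unit weights and exponent
    2.\<close>
  have "(\<Sum>z\<in>?V. 1 * ?s z) ^ Suc 1 \<le> (\<Sum>z\<in>?V. 1) ^ 1 * (\<Sum>z\<in>?V. 1 * ?s z ^ Suc 1)"
    using G u by (intro weighted_power_mean[where p = "\<lambda>_. 1"]) (auto simp: finite_simple_graph_def intro!: sum_nonneg)
  then show ?thesis
    unfolding deg codeg by (simp add: numeral_2_eq_2)
qed

section \<open>Subdivisions of complete graphs\<close>

lemma sum_PiE_insert:
  fixes F :: "('a \<Rightarrow> 'b) \<Rightarrow> 'c :: comm_monoid_add"
  assumes "j \<notin> J"
  shows "(\<Sum>f\<in>insert j J \<rightarrow>\<^sub>E V. F f) = (\<Sum>x\<in>V. \<Sum>g\<in>J \<rightarrow>\<^sub>E V. F (g(j := x)))"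
proof -
  have "(\<Sum>f\<in>insert j J \<rightarrow>\<^sub>E V. F f) = (\<Sum>(x, g)\<in>V \<times> (J \<rightarrow>\<^sub>E V). F (g(j := x)))"
    unfolding PiE_insert_eq using inj_combinator[OF assms]
    by (subst sum.reindex) (auto simp: case_prod_unfold)
  then show ?thesis
    by (simp add: sum.cartesian_product)
qed

text \<open>The pairs through \<open>j\<close> are split off because they supply the codegree
  factors that change the weights when one clique vertex is fixed.\<close>

lemma prod_pairs_insert:
  fixes F :: "'a set \<Rightarrow> 'b :: comm_monoid_mult"
  assumes "finite J" "j \<notin> J"
  shows "(\<Prod>e | e \<subseteq> insert j J \<and> card e = 2. F e)
    = (\<Prod>i\<in>J. F {j, i}) * (\<Prod>e | e \<subseteq> J \<and> card e = 2. F e)"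
proof -
  have "{e. e \<subseteq> insert j J \<and> card e = 2} = (\<lambda>i. {j, i}) ` J \<union> {e. e \<subseteq> J \<and> card e = 2}"
    using assms(2) by (auto simp: card_2_iff image_iff)
  moreover have "inj_on (\<lambda>i. {j, i}) J"
    by (auto simp: inj_on_def doubleton_eq_iff)
  moreover have "(\<lambda>i. {j, i}) ` J \<inter> {e. e \<subseteq> J \<and> card e = 2} = {}"
    using assms(2) by auto
  ultimately show ?thesis
    using assms(1) by (simp add: prod.union_disjoint prod.reindex)
qed

text \<open>Induction on the clique size: after fixing the image \<open>x\<close> of one vertex, the others carry the
  weights \<open>\<lambda>y. u y * codeg G x y\<close>. The exponent of the degree is the one for which the power mean
  inequality with weights \<open>u x * deg G x ^ Suc k\<close> matches the bound on the codegree form.\<close>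

lemma clique_form_ge:
  assumes G: "finite_simple_graph G"
    and "finite I" "card I = Suc k" "\<And>x. x \<in> verts G \<Longrightarrow> 0 \<le> u x"
  shows "(\<Sum>x\<in>verts G. u x * deg G x ^ k) ^ Suc k
    \<le> real (card (verts G)) ^ (Suc k choose 2) *
      (\<Sum>f\<in>I \<rightarrow>\<^sub>E verts G. (\<Prod>i\<in>I. u (f i)) *
        (\<Prod>e | e \<subseteq> I \<and> card e = 2. real (card (common_nbrs G (f ` e)))))"
  using assms(2-)
proof (induction k arbitrary: I u)
  case 0
  then obtain j where I: "I = {j}"
    by (auto simp: card_Suc_eq)
  have no_pairs: "{e. e \<subseteq> {j} \<and> card e = 2} = {}"
    by (auto simp: subset_singleton_iff)
  show ?case
    unfolding I no_pairs by (simp add: sum_PiE_insert binomial_eq_0)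
next
  case (Suc k)
  let ?V = "verts G" and ?n = "real (card (verts G))"
  let ?c = "\<lambda>f e. real (card (common_nbrs G (f ` e)))"
  let ?S = "\<Sum>f\<in>I \<rightarrow>\<^sub>E ?V. (\<Prod>i\<in>I. u (f i)) * (\<Prod>e | e \<subseteq> I \<and> card e = 2. ?c f e)"
  obtain j J where I: "I = insert j J" and j: "j \<notin> J" and J: "finite J" "card J = Suc k"
    using Suc.prems(2) unfolding card_Suc_eq_finite[of I "Suc k"] by blast
  \<comment> \<open>\<open>T x\<close> collects the maps that send \<open>j\<close> to
    \<open>x\<close>, and \<open>g x\<close> is the sum that the induction hypothesis bounds for the
    changed weights.\<close>
  define T where "T x = (\<Sum>g\<in>J \<rightarrow>\<^sub>E ?V. (\<Prod>i\<in>J. u (g i) * codeg G x (g i)) *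
    (\<Prod>e | e \<subseteq> J \<and> card e = 2. ?c g e))" for x
  define g where "g x = (\<Sum>y\<in>?V. u y * codeg G x y * deg G y ^ k)" for x
  define A where "A = (\<Sum>x\<in>?V. u x * deg G x ^ Suc k)"
  have u: "0 \<le> u x" if "x \<in> ?V" for x
    using Suc.prems(3) that .
  have finV: "finite ?V"
    using G by (simp add: finite_simple_graph_def)
  have A: "0 \<le> A"
    unfolding A_def using u by (intro sum_nonneg) auto
  have g: "0 \<le> g x" for x
    unfolding g_def using u by (intro sum_nonneg) auto
  have IH: "g x ^ Suc k \<le> ?n ^ (Suc k choose 2) * T x" for x
    unfolding g_def T_def using Suc.IH[OF J, of "\<lambda>y. u y * codeg G x y"] u by simp
  have S: "?S = (\<Sum>x\<in>?V. u x * T x)"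
  proof -
    have "(\<Prod>i\<in>I. u ((h(j := x)) i)) * (\<Prod>e | e \<subseteq> I \<and> card e = 2. ?c (h(j := x)) e)
        = u x * ((\<Prod>i\<in>J. u (h i) * codeg G x (h i)) * (\<Prod>e | e \<subseteq> J \<and> card e = 2. ?c h e))" for x h
    proof -
      have u': "(\<Prod>i\<in>J. u ((h(j := x)) i)) = (\<Prod>i\<in>J. u (h i))"
        using j by (intro prod.cong) auto
      have c': "(\<Prod>i\<in>J. ?c (h(j := x)) {j, i}) = (\<Prod>i\<in>J. codeg G x (h i))"
      proof (rule prod.cong[OF refl])
        fix i
        assume "i \<in> J"
        then have "(h(j := x)) ` {j, i} = {x, h i}"
          using j by auto
        then show "?c (h(j := x)) {j, i} = codeg G x (h i)"
          by (simp only:)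
      qed
      have e': "(\<Prod>e | e \<subseteq> J \<and> card e = 2. ?c (h(j := x)) e) = (\<Prod>e | e \<subseteq> J \<and> card e = 2. ?c h e)"
      proof (rule prod.cong[OF refl])
        fix e
        assume "e \<in> {e. e \<subseteq> J \<and> card e = 2}"
        then have "(h(j := x)) ` e = h ` e"
          using j by (intro image_cong) auto
        then show "?c (h(j := x)) e = ?c h e"
          by (simp only:)
      qed
      show ?thesis
        unfolding I prod_pairs_insert[OF J(1) j] c' e' prod.insert[OF J(1) j] u' prod.distrib
        by (simp add: mult_ac)
    qed
    then show ?thesis
      by (simp only: I sum_PiE_insert[OF j] T_def sum_distrib_left)
  qed
  \<comment> \<open>Codegrees are at most degrees, so \<open>g x\<close> vanishes where the degree
    does. Hence the quotient \<open>g x / deg G x\<close> is harmless even at isolated vertices,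
    where it is 0 by convention.\<close>
  have r0: "g x = 0" if "deg G x = 0" for x
  proof -
    have "codeg G x y \<le> deg G x" for y
      using finV by (auto simp: common_nbrs_def intro!: card_mono)
    then have "codeg G x y = 0" for y
      using that by (metis of_nat_le_0_iff of_nat_0)
    then show ?thesis
      by (simp add: g_def)
  qed
  \<comment> \<open>These are the two moments in the power mean inequality with weights
    \<open>u x * deg G x ^ Suc k\<close>, of total weight \<open>A\<close>, and values
    \<open>g x / deg G x\<close>: the degrees cancel completely in the higher one.\<close>
  have ps: "u x * deg G x ^ Suc k * (g x / deg G x) = u x * deg G x ^ k * g x"
    and ps': "u x * deg G x ^ Suc k * (g x / deg G x) ^ Suc k = u x * g x ^ Suc k" for x
    using r0[of x] by (cases "deg G x = 0"; simp add: power_divide)+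
  have pull: "(\<Sum>x\<in>?V. u x * (q * T x)) = q * (\<Sum>x\<in>?V. u x * T x)" for q
    by (simp add: sum_distrib_left mult_ac)
  have choose: "Suc (Suc k) choose 2 = Suc k + (Suc k choose 2)"
    by (simp add: numeral_2_eq_2)
  \<comment> \<open>The factor \<open>A ^ k\<close> is the power of the total weight that the power
    mean inequality produces on the other side.\<close>
  have square: "(A\<^sup>2) ^ Suc k = A ^ k * A ^ Suc (Suc k)"
    by (simp flip: power_mult power_add add: mult_2)
  have "A\<^sup>2 = (\<Sum>x\<in>?V. (u x * deg G x ^ k) * deg G x)\<^sup>2"
    by (simp add: A_def mult_ac)
  \<comment> \<open>The codegree form is used with weights \<open>u x * deg G x ^ k\<close>; its
    inner sum over \<open>y\<close> is then \<open>g x\<close>.\<close>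
  also have "\<dots> \<le> ?n * (\<Sum>x\<in>?V. \<Sum>y\<in>?V. (u x * deg G x ^ k) * (u y * deg G y ^ k) * codeg G x y)"
    using u by (intro codeg_form_ge G) auto
  also have "(\<Sum>x\<in>?V. \<Sum>y\<in>?V. (u x * deg G x ^ k) * (u y * deg G y ^ k) * codeg G x y)
      = (\<Sum>x\<in>?V. u x * deg G x ^ k * g x)"
    by (simp only: g_def sum_distrib_left mult_ac)
  finally have "(A\<^sup>2) ^ Suc k \<le> (?n * (\<Sum>x\<in>?V. u x * deg G x ^ k * g x)) ^ Suc k"
    by (rule power_mono) simp
  also have "\<dots> = ?n ^ Suc k * (\<Sum>x\<in>?V. u x * deg G x ^ k * g x) ^ Suc k"
    by (rule power_mult_distrib)
  also have "\<dots> \<le> ?n ^ Suc k * (A ^ k * (\<Sum>x\<in>?V. u x * g x ^ Suc k))"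
    using weighted_power_mean[OF finV, of "\<lambda>x. u x * deg G x ^ Suc k" "\<lambda>x. g x / deg G x" k] u g
    by (intro mult_left_mono) (simp_all only: ps ps' A_def, auto)
  also have "\<dots> \<le> ?n ^ Suc k * (A ^ k * (\<Sum>x\<in>?V. u x * (?n ^ (Suc k choose 2) * T x)))"
    using IH u A by (intro mult_left_mono sum_mono) auto
  also have "\<dots> = A ^ k * (?n ^ (Suc (Suc k) choose 2) * ?S)"
    unfolding S choose power_add pull by (simp only: mult_ac)
  finally have main: "A ^ k * A ^ Suc (Suc k) \<le> A ^ k * (?n ^ (Suc (Suc k) choose 2) * ?S)"
    by (simp only: square)
  have "0 \<le> ?S"
    using u Suc.prems(1)
    by (intro sum_nonneg mult_nonneg_nonneg prod_nonneg) (auto simp: PiE_iff)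
  \<comment> \<open>For positive \<open>A\<close> the factor \<open>A ^ k\<close> cancels; for
    \<open>A = 0\<close> the left side is 0 and the right side nonnegative.\<close>
  then show ?case
    using main A unfolding A_def[symmetric] by (cases "A = 0") auto
qed

text \<open>The clique bound with unit weights involves the sum of the powers
  \<open>deg G x ^ m\<close> with \<open>k = Suc m\<close>. The power mean inequality bounds it from
  below by the degree sum, which is twice the number of edges.\<close>

lemma sidorenko_subdivision_complete_graph:
  assumes "k \<ge> 1"
  shows "sidorenko (subdivision (complete_graph k))"
proof (rule sidorenko_subdivisionI[OF finite_simple_graph_complete_graph])
  fix G :: "nat ugraph"
  assume G: "finite_simple_graph G" and ne: "verts G \<noteq> {}"
  obtain m where k: "k = Suc m"
    using assms by (cases k) auto
  let ?n = "real (card (verts G))" and ?C = "k choose 2" and ?D = "2 * real (card (edges G))"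
  let ?S = "\<Sum>f\<in>{..<k} \<rightarrow>\<^sub>E verts G.
    \<Prod>e | e \<subseteq> {..<k} \<and> card e = 2. real (card (common_nbrs G (f ` e)))"
  have finV: "finite (verts G)"
    using G by (simp add: finite_simple_graph_def)
  have n: "0 < ?n"
    using finV ne by (simp add: card_gt_0_iff)
  have C: "2 * ?C = m * k"
    by (simp add: k choose_two)
  have "(?D ^ m * ?n) ^ k \<le> (?n ^ m * (\<Sum>x\<in>verts G. deg G x ^ m)) ^ k"
    using power_mean[OF finV, of "deg G" m] by (intro power_mono) (simp_all add: sum_deg[OF G])
  also have "\<dots> = ?n ^ (m * k) * (\<Sum>x\<in>verts G. deg G x ^ m) ^ k"
    by (simp add: power_mult_distrib power_mult)
  also have "\<dots> \<le> ?n ^ (m * k) * (?n ^ ?C * ?S)"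
    using clique_form_ge[OF G, of "{..<k}" m "\<lambda>_. 1"] by (intro mult_left_mono) (simp_all add: k)
  finally have le: "?D ^ (m * k) * ?n ^ k \<le> ?n ^ (m * k) * (?n ^ ?C * ?S)"
    by (simp add: power_mult_distrib power_mult)
  \<comment> \<open>Denominators are cleared with \<open>c\<close> in place of the binomial
    coefficient: one more factor \<open>?n ^ c\<close> raises the power of \<open>?n\<close> on the
    right to \<open>4 * c\<close>, matching the denominator of the density.\<close>
  have "?n ^ (k + c) * (?D / ?n\<^sup>2) ^ (2 * c) \<le> s"
    if "?D ^ (2 * c) * ?n ^ k \<le> ?n ^ (2 * c) * (?n ^ c * s)" for c s
  proof -
    have "?n ^ c * (?D ^ (2 * c) * ?n ^ k) \<le> ?n ^ c * (?n ^ (2 * c) * (?n ^ c * s))"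
      using that by (rule mult_left_mono) simp
    also have "\<dots> = ?n ^ (c + 2 * c + c) * s"
      by (simp only: power_add mult.assoc)
    also have "c + 2 * c + c = 2 * (2 * c)"
      by simp
    also have "?n ^ (2 * (2 * c)) = (?n\<^sup>2) ^ (2 * c)"
      by (rule power_mult)
    finally have "?n ^ (k + c) * ?D ^ (2 * c) \<le> (?n\<^sup>2) ^ (2 * c) * s"
      by (simp only: power_add mult_ac)
    then show ?thesis
      using n by (simp add: power_divide pos_divide_le_eq mult_ac)
  qed
  from this[of ?C ?S] le have "?n ^ (k + ?C) * (?D / ?n\<^sup>2) ^ (2 * ?C) \<le> ?S"
    unfolding C .
  then show "?n ^ (card (verts (complete_graph k)) + card (edges (complete_graph k))) *
      (?D / ?n\<^sup>2) ^ (2 * card (edges (complete_graph k)))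
    \<le> (\<Sum>f\<in>verts (complete_graph k) \<rightarrow>\<^sub>E verts G.
        \<Prod>e\<in>edges (complete_graph k). real (card (common_nbrs G (f ` e))))"
    by (simp add: complete_graph_def n_subsets)
qed

section \<open>Random blow-ups\<close>

text \<open>Splits a map into a blow-up into its vertex part \<open>f\<close> and its level part
  \<open>g\<close>.\<close>

lemma sum_PiE_Times:
  fixes h :: "('a \<Rightarrow> 'b \<times> 'c) \<Rightarrow> 'd :: comm_monoid_add"
  shows "(\<Sum>F\<in>A \<rightarrow>\<^sub>E B \<times> C. h F) = (\<Sum>g\<in>A \<rightarrow>\<^sub>E C. \<Sum>f\<in>A \<rightarrow>\<^sub>E B. h (\<lambda>v\<in>A. (f v, g v)))"
proof -
  have "(\<Sum>F\<in>A \<rightarrow>\<^sub>E B \<times> C. h F) =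
      (\<Sum>(g, f)\<in>(A \<rightarrow>\<^sub>E C) \<times> (A \<rightarrow>\<^sub>E B). h (\<lambda>v\<in>A. (f v, g v)))"
  proof (rule sum.reindex_bij_witness[where i = "\<lambda>(g, f). \<lambda>v\<in>A. (f v, g v)"
        and j = "\<lambda>F. (\<lambda>v\<in>A. snd (F v), \<lambda>v\<in>A. fst (F v))"])
    fix F
    assume F: "F \<in> A \<rightarrow>\<^sub>E B \<times> C"
    then have eq: "(\<lambda>v\<in>A. ((\<lambda>v\<in>A. fst (F v)) v, (\<lambda>v\<in>A. snd (F v)) v)) = F"
      by (auto simp: fun_eq_iff PiE_iff extensional_def)
    then show "(case (\<lambda>v\<in>A. snd (F v), \<lambda>v\<in>A. fst (F v)) of (g, f) \<Rightarrow> \<lambda>v\<in>A. (f v, g v)) = F"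
      by simp
    show "(\<lambda>v\<in>A. snd (F v), \<lambda>v\<in>A. fst (F v)) \<in> (A \<rightarrow>\<^sub>E C) \<times> (A \<rightarrow>\<^sub>E B)"
      using F by (auto simp: PiE_iff mem_Times_iff)
    show "(case (\<lambda>v\<in>A. snd (F v), \<lambda>v\<in>A. fst (F v)) of (g, f) \<Rightarrow> h (\<lambda>v\<in>A. (f v, g v))) = h F"
      using eq by simp
  qed (auto simp: fun_eq_iff PiE_iff extensional_def)
  then show ?thesis
    by (simp add: sum.cartesian_product)
qed

text \<open>Independence of conditions on different coordinates: for uniformly random \<phi>, all of
  them hold with probability the product of the \<open>card (C e) / card V\<close>. Denominators are
  cleared to stay within natural numbers.\<close>

lemma card_PiE_constrained:
  assumes P: "finite P" and q: "inj_on q I" "q ` I \<subseteq> P" and C: "\<And>e. e \<in> I \<Longrightarrow> C e \<subseteq> V"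
  shows "card {\<phi> \<in> P \<rightarrow>\<^sub>E V. \<forall>e\<in>I. \<phi> (q e) \<in> C e} * card V ^ card I
    = card V ^ card P * (\<Prod>e\<in>I. card (C e))"
proof -
  define B where "B p = (if p \<in> q ` I then C (inv_into I q p) else V)" for p
  have B: "B (q e) = C e" if "e \<in> I" for e
    using that q(1) by (simp add: B_def)
  have "{\<phi> \<in> P \<rightarrow>\<^sub>E V. \<forall>e\<in>I. \<phi> (q e) \<in> C e} = Pi\<^sub>E P B"
  proof (intro equalityI subsetI)
    fix \<phi>
    assume "\<phi> \<in> {\<phi> \<in> P \<rightarrow>\<^sub>E V. \<forall>e\<in>I. \<phi> (q e) \<in> C e}"
    then show "\<phi> \<in> Pi\<^sub>E P B"
      using B by (auto simp: PiE_iff B_def)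
  next
    fix \<phi>
    assume \<phi>: "\<phi> \<in> Pi\<^sub>E P B"
    have "B p \<subseteq> V" for p
      using C B by (cases "p \<in> q ` I") (auto simp: B_def)
    then have "\<phi> p \<in> V" if "p \<in> P" for p
      using PiE_mem[OF \<phi> that] by blast
    moreover have "\<phi> (q e) \<in> C e" if "e \<in> I" for e
      using \<phi> that B q(2) by (auto simp: PiE_iff)
    ultimately show "\<phi> \<in> {\<phi> \<in> P \<rightarrow>\<^sub>E V. \<forall>e\<in>I. \<phi> (q e) \<in> C e}"
      using \<phi> by (simp add: PiE_iff)
  qed
  then have "card {\<phi> \<in> P \<rightarrow>\<^sub>E V. \<forall>e\<in>I. \<phi> (q e) \<in> C e} = (\<Prod>p\<in>P. card (B p))"
    using P by (simp add: card_PiE)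
  also have "\<dots> = (\<Prod>p\<in>P - q ` I. card (B p)) * (\<Prod>p\<in>q ` I. card (B p))"
    by (rule prod.subset_diff[OF q(2) P])
  also have "(\<Prod>p\<in>P - q ` I. card (B p)) = card V ^ card (P - q ` I)"
    by (simp add: B_def)
  also have "(\<Prod>p\<in>q ` I. card (B p)) = (\<Prod>e\<in>I. card (C e))"
    using B by (simp add: prod.reindex[OF q(1)])
  finally have eq: "card {\<phi> \<in> P \<rightarrow>\<^sub>E V. \<forall>e\<in>I. \<phi> (q e) \<in> C e} =
    card V ^ card (P - q ` I) * (\<Prod>e\<in>I. card (C e))" .
  have "card P = card (P - q ` I) + card I"
    using q P by (metis card_Diff_subset card_image card_mono finite_subset le_add_diff_inverse2)
  then show ?thesis
    by (simp add: eq power_add)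
qed

abbreviation pairs :: "nat \<Rightarrow> nat set set" where
  "pairs N \<equiv> {p. p \<subseteq> {..<N} \<and> card p = 2}"

lemma finite_pairs: "finite (pairs N)"
  by simp

text \<open>Every pair \<open>{i, j}\<close> of levels gets a vertex \<open>\<phi> {i, j}\<close> of \<open>G\<close>, and \<open>(x, i)\<close>, \<open>(y, j)\<close> are
  joined if that vertex is a common neighbour of \<open>x\<close> and \<open>y\<close>. For uniformly random \<open>\<phi>\<close> this has
  probability \<open>codeg G x y / card (verts G)\<close>, independently for different pairs of levels.\<close>

definition blowup :: "'b ugraph \<Rightarrow> nat \<Rightarrow> (nat set \<Rightarrow> 'b) \<Rightarrow> ('b \<times> nat) ugraph" where
  "blowup G N \<phi> = \<lparr>verts = verts G \<times> {..<N},
     edges = {A. A \<subseteq> verts G \<times> {..<N} \<and> card A = 2 \<and> card (snd ` A) = 2 \<and>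
       \<phi> (snd ` A) \<in> common_nbrs G (fst ` A)}\<rparr>"

lemma finite_simple_graph_blowup:
  "finite_simple_graph G \<Longrightarrow> finite_simple_graph (blowup G N \<phi>)"
  by (simp add: finite_simple_graph_def blowup_def)

lemma Hom_blowup_iff:
  assumes H: "finite_simple_graph H"
    and f: "f \<in> verts H \<rightarrow>\<^sub>E verts G" and g: "g \<in> verts H \<rightarrow>\<^sub>E {..<N}"
  shows "(\<lambda>v\<in>verts H. (f v, g v)) \<in> Hom H (blowup G N \<phi>)
    \<longleftrightarrow> (\<forall>e\<in>edges H. card (g ` e) = 2 \<and> \<phi> (g ` e) \<in> common_nbrs G (f ` e))"
proof -
  let ?F = "\<lambda>v\<in>verts H. (f v, g v)"
  have "?F ` e \<in> edges (blowup G N \<phi>) \<longleftrightarrow> card (g ` e) = 2 \<and> \<phi> (g ` e) \<in> common_nbrs G (f ` e)"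
    if "e \<in> edges H" for e
  proof -
    have e: "e \<subseteq> verts H" "card e = 2"
      using H that by (auto simp: finite_simple_graph_def)
    then have fin: "finite e"
      by (simp add: card_ge_0_finite)
    let ?A = "(\<lambda>v. (f v, g v)) ` e"
    have A: "fst ` ?A = f ` e" "snd ` ?A = g ` e"
      by (simp_all add: image_image)
    \<comment> \<open>Ends on different levels are different vertices of the blow-up, whether or not
      \<open>f\<close> identifies them.\<close>
    have "card ?A = 2" if "card (g ` e) = 2"
    proof -
      have "card (g ` e) \<le> card ?A"
        unfolding A(2)[symmetric] using fin by (intro card_image_le finite_imageI)
      then show ?thesis
        using that card_image_le[OF fin, of "\<lambda>v. (f v, g v)"] e(2) by simp
    qed
    moreover have "?A \<subseteq> verts G \<times> {..<N}"
      using f g e(1) by (auto simp: PiE_iff)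
    ultimately have "?A \<in> edges (blowup G N \<phi>) \<longleftrightarrow>
        card (g ` e) = 2 \<and> \<phi> (g ` e) \<in> common_nbrs G (f ` e)"
      unfolding blowup_def ugraph.simps mem_Collect_eq A by blast
    moreover have "?F ` e = ?A"
      using e(1) by (intro image_cong) auto
    ultimately show ?thesis
      by (simp only:)
  qed
  moreover have "?F \<in> verts H \<rightarrow>\<^sub>E verts G \<times> {..<N}"
    using f g by auto
  ultimately show ?thesis
    unfolding Hom_iff[OF H] by (simp add: blowup_def)
qed

text \<open>Double counting of pairs of a choice \<phi> and a homomorphism. For injective level maps
  \<open>g\<close> the number of suitable \<phi> is exact by independence; for all others it is
  bounded by the number of all \<phi>. The factor \<open>n ^ m\<close> clears the denominators of
  the probabilities.\<close>

lemma sum_card_Hom_blowup_le: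
  fixes G :: "'b ugraph" and H :: "'a ugraph" and N :: nat
  assumes H: "finite_simple_graph H" and G: "finite_simple_graph G"
  defines "n \<equiv> real (card (verts G))" and "v \<equiv> card (verts H)" and "m \<equiv> card (edges H)"
  defines "inj_count \<equiv> real (card {g \<in> verts H \<rightarrow>\<^sub>E {..<N}. inj_on g (verts H)})"
  shows "(\<Sum>\<phi>\<in>pairs N \<rightarrow>\<^sub>E verts G. real (card (Hom H (blowup G N \<phi>)))) * n ^ m
    \<le> n ^ card (pairs N) * (inj_count *
        (\<Sum>f\<in>verts H \<rightarrow>\<^sub>E verts G. \<Prod>e\<in>edges H. real (card (common_nbrs G (f ` e)))) +
      (real N ^ v - inj_count) * n ^ (v + m))"
proof -
  let ?V = "verts G" and ?\<Phi> = "pairs N \<rightarrow>\<^sub>E verts G"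
  let ?f = "verts H \<rightarrow>\<^sub>E verts G" and ?g = "verts H \<rightarrow>\<^sub>E {..<N}"
  let ?W = "\<lambda>f. \<Prod>e\<in>edges H. real (card (common_nbrs G (f ` e)))"
  let ?F = "\<lambda>f g. \<lambda>v\<in>verts H. (f v, g v)"
  let ?I = "{g \<in> ?g. inj_on g (verts H)}"
  define c where "c f g = real (card {\<phi> \<in> ?\<Phi>. ?F f g \<in> Hom H (blowup G N \<phi>)})" for f g
  have finV: "finite ?V" and finH: "finite (verts H)"
    using G H by (simp_all add: finite_simple_graph_def)
  have fin: "finite ?\<Phi>" "finite ?f" "finite ?g"
    using finV finH finite_pairs by (simp_all add: finite_PiE)
  have card: "real (card ?\<Phi>) = n ^ card (pairs N)" "real (card ?f) = n ^ v" "real (card ?g) = real N ^ v"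
    using finH finite_pairs by (simp_all add: card_funcsetE n_def v_def)
  have sub: "e \<subseteq> verts H" if "e \<in> edges H" for e
    using H that by (simp add: finite_simple_graph_def)
  have c_inj: "c f g * n ^ m = n ^ card (pairs N) * ?W f"
    if f: "f \<in> ?f" and g: "g \<in> ?I" for f g
  proof -
    have two: "card (g ` e) = 2" if "e \<in> edges H" for e
    proof -
      have "inj_on g e"
        using g sub[OF that] inj_on_subset by blast
      then show ?thesis
        using H that by (simp add: card_image finite_simple_graph_def)
    qed
    have gN: "g ` e \<subseteq> {..<N}" if "e \<in> edges H" for e
      using g sub[OF that] by (auto simp: PiE_iff)
    have "{\<phi> \<in> ?\<Phi>. ?F f g \<in> Hom H (blowup G N \<phi>)}
        = {\<phi> \<in> ?\<Phi>. \<forall>e\<in>edges H. \<phi> (g ` e) \<in> common_nbrs G (f ` e)}"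
      using Hom_blowup_iff[OF H f, of g] g two by auto
    \<comment> \<open>Different edges of \<open>H\<close> occupy different pairs of levels, so their
      conditions concern different coordinates of \<phi>.\<close>
    moreover have "inj_on ((`) g) (edges H)"
    proof (rule inj_onI)
      fix d e
      assume "d \<in> edges H" "e \<in> edges H" "g ` d = g ` e"
      then show "d = e"
        using g sub inj_on_image_eq_iff[of g "verts H" d e] by simp
    qed
    then have "card {\<phi> \<in> ?\<Phi>. \<forall>e\<in>edges H. \<phi> (g ` e) \<in> common_nbrs G (f ` e)} * card ?V ^ card (edges H)
        = card ?V ^ card (pairs N) * (\<Prod>e\<in>edges H. card (common_nbrs G (f ` e)))"
      using gN two
      by (intro card_PiE_constrained finite_pairs common_nbrs_subset) auto
    ultimately have "card {\<phi> \<in> ?\<Phi>. ?F f g \<in> Hom H (blowup G N \<phi>)} * card ?V ^ card (edges H)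
        = card ?V ^ card (pairs N) * (\<Prod>e\<in>edges H. card (common_nbrs G (f ` e)))"
      by (simp only:)
    from arg_cong[OF this, of real] show ?thesis
      by (simp only: c_def n_def m_def of_nat_mult of_nat_power of_nat_prod)
  qed
  have c_le: "c f g * n ^ m \<le> n ^ card (pairs N) * n ^ m" for f g
    unfolding c_def card(1)[symmetric]
    by (intro mult_right_mono of_nat_mono card_mono fin) (auto simp: n_def)
  have "(\<Sum>\<phi>\<in>?\<Phi>. real (card (Hom H (blowup G N \<phi>))))
      = (\<Sum>\<phi>\<in>?\<Phi>. \<Sum>F\<in>verts H \<rightarrow>\<^sub>E ?V \<times> {..<N}. of_bool (F \<in> Hom H (blowup G N \<phi>)))"
  proof (rule sum.cong[OF refl])
    fix \<phi>
    have "Hom H (blowup G N \<phi>) \<subseteq> verts H \<rightarrow>\<^sub>E ?V \<times> {..<N}"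
      by (auto simp: Hom_def blowup_def)
    moreover have "finite (verts H \<rightarrow>\<^sub>E ?V \<times> {..<N})"
      using finV finH by (simp add: finite_PiE)
    ultimately show "real (card (Hom H (blowup G N \<phi>)))
        = (\<Sum>F\<in>verts H \<rightarrow>\<^sub>E ?V \<times> {..<N}. of_bool (F \<in> Hom H (blowup G N \<phi>)))"
      by (simp add: sum_of_bool_eq Int_absorb1)
  qed
  also have "\<dots> = (\<Sum>F\<in>verts H \<rightarrow>\<^sub>E ?V \<times> {..<N}. \<Sum>\<phi>\<in>?\<Phi>. of_bool (F \<in> Hom H (blowup G N \<phi>)))"
    by (rule sum.swap)
  also have "\<dots> = (\<Sum>g\<in>?g. \<Sum>f\<in>?f. c f g)"
    using fin(1) by (simp only: sum_PiE_Times c_def sum_of_bool_eq Int_def mem_Collect_eq)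
  also have "\<dots> * n ^ m = (\<Sum>g\<in>?g. \<Sum>f\<in>?f. c f g * n ^ m)"
    by (simp add: sum_distrib_right)
  also have "\<dots> = (\<Sum>g\<in>?I. \<Sum>f\<in>?f. c f g * n ^ m) + (\<Sum>g\<in>?g - ?I. \<Sum>f\<in>?f. c f g * n ^ m)"
    using fin(3) by (subst sum.subset_diff[of ?I ?g]) auto
  also have "\<dots> \<le> (\<Sum>g\<in>?I. \<Sum>f\<in>?f. n ^ card (pairs N) * ?W f) +
      (\<Sum>g\<in>?g - ?I. \<Sum>f\<in>?f. n ^ card (pairs N) * n ^ m)"
    using c_inj c_le by (intro add_mono sum_mono) auto
  also have "(\<Sum>g\<in>?I. \<Sum>f\<in>?f. n ^ card (pairs N) * ?W f) = inj_count * (n ^ card (pairs N) * (\<Sum>f\<in>?f. ?W f))"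
    by (simp add: inj_count_def sum_distrib_left)
  also have "(\<Sum>g\<in>?g - ?I. \<Sum>f\<in>?f. n ^ card (pairs N) * n ^ m) =
      (real N ^ v - inj_count) * (n ^ v * (n ^ card (pairs N) * n ^ m))"
  proof -
    have "real (card (?g - ?I)) = real N ^ v - inj_count"
      unfolding inj_count_def card(3)[symmetric] using fin(3)
      by (subst card_Diff_subset) (auto simp: of_nat_diff card_mono)
    then show ?thesis
      using card(2) by simp
  qed
  finally show ?thesis
    by (simp add: power_add algebra_simps)
qed

text \<open>Linearity of expectation over ordered pairs of vertices: those on one level are never
  joined, and the \<open>N * (N - 1)\<close> ordered pairs of different levels each contribute the
  codegrees divided by \<open>n\<close>.\<close>

lemma sum_card_edges_blowup:
  assumes G: "finite_simple_graph G"
  defines "n \<equiv> real (card (verts G))"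
  shows "n * (\<Sum>\<phi>\<in>pairs N \<rightarrow>\<^sub>E verts G. 2 * real (card (edges (blowup G N \<phi>))))
    = n ^ card (pairs N) * (real N * (real N - 1) * (\<Sum>x\<in>verts G. \<Sum>y\<in>verts G. codeg G x y))"
proof -
  let ?V = "verts G" and ?\<Phi> = "pairs N \<rightarrow>\<^sub>E verts G"
  let ?U = "?V \<times> {..<N}"
  define c where "c a b = real (card {\<phi> \<in> ?\<Phi>. {a, b} \<in> edges (blowup G N \<phi>)})" for a b
  have finV: "finite ?V"
    using G by (simp add: finite_simple_graph_def)
  have fin: "finite ?\<Phi>"
    using finV finite_pairs by (simp add: finite_PiE)
  have c: "n * c (x, i) (y, j) = n ^ card (pairs N) * (of_bool (i \<noteq> j) * codeg G x y)"
    if "x \<in> ?V" "y \<in> ?V" "i < N" "j < N" for x y i j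
  proof (cases "i = j")
    case True
    then show ?thesis
      by (simp add: c_def blowup_def)
  next
    case False
    then have "{\<phi> \<in> ?\<Phi>. {(x, i), (y, j)} \<in> edges (blowup G N \<phi>)}
        = {\<phi> \<in> ?\<Phi>. \<forall>e\<in>{{i, j}}. \<phi> (id e) \<in> common_nbrs G {x, y}}"
      using that by (auto simp: blowup_def)
    moreover have "card {\<phi> \<in> ?\<Phi>. \<forall>e\<in>{{i, j}}. \<phi> (id e) \<in> common_nbrs G {x, y}} * card ?V ^ card {{i, j}}
        = card ?V ^ card (pairs N) * (\<Prod>e\<in>{{i, j}}. card (common_nbrs G {x, y}))"
      using that False by (intro card_PiE_constrained finite_pairs common_nbrs_subset) auto
    ultimately have "card {\<phi> \<in> ?\<Phi>. {(x, i), (y, j)} \<in> edges (blowup G N \<phi>)} * card ?V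
        = card ?V ^ card (pairs N) * card (common_nbrs G {x, y})"
      by simp
    from arg_cong[OF this, of real] have "c (x, i) (y, j) * n = n ^ card (pairs N) * codeg G x y"
      by (simp only: c_def n_def of_nat_mult of_nat_power)
    then show ?thesis
      using False by (simp add: mult.commute)
  qed
  have "2 * real (card (edges (blowup G N \<phi>))) = (\<Sum>a\<in>?U. \<Sum>b\<in>?U. of_bool ({a, b} \<in> edges (blowup G N \<phi>)))" for \<phi>
  proof -
    have "{(a, b). {a, b} \<in> edges (blowup G N \<phi>)} \<subseteq> ?U \<times> ?U"
      by (auto simp: blowup_def)
    then have eq: "(?U \<times> ?U) \<inter> {p. {fst p, snd p} \<in> edges (blowup G N \<phi>)} = {(a, b). {a, b} \<in> edges (blowup G N \<phi>)}"
      by auto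
    have "2 * real (card (edges (blowup G N \<phi>))) = real (card {(a, b). {a, b} \<in> edges (blowup G N \<phi>)})"
      by (simp add: card_adjacent_pairs[OF finite_simple_graph_blowup[OF G]])
    also have "\<dots> = (\<Sum>p\<in>?U \<times> ?U. of_bool ({fst p, snd p} \<in> edges (blowup G N \<phi>)))"
      using finV by (simp add: sum_of_bool_eq eq)
    finally show ?thesis
      by (simp add: sum.cartesian_product case_prod_unfold)
  qed
  then have "(\<Sum>\<phi>\<in>?\<Phi>. 2 * real (card (edges (blowup G N \<phi>))))
      = (\<Sum>\<phi>\<in>?\<Phi>. \<Sum>a\<in>?U. \<Sum>b\<in>?U. of_bool ({a, b} \<in> edges (blowup G N \<phi>)))"
    by simp
  also have "\<dots> = (\<Sum>a\<in>?U. \<Sum>\<phi>\<in>?\<Phi>. \<Sum>b\<in>?U. of_bool ({a, b} \<in> edges (blowup G N \<phi>)))"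
    by (rule sum.swap)
  also have "\<dots> = (\<Sum>a\<in>?U. \<Sum>b\<in>?U. \<Sum>\<phi>\<in>?\<Phi>. of_bool ({a, b} \<in> edges (blowup G N \<phi>)))"
    by (intro sum.cong sum.swap refl)
  also have "\<dots> = (\<Sum>a\<in>?U. \<Sum>b\<in>?U. c a b)"
    using fin by (simp only: c_def sum_of_bool_eq Int_def mem_Collect_eq)
  finally have "n * (\<Sum>\<phi>\<in>?\<Phi>. 2 * real (card (edges (blowup G N \<phi>)))) = (\<Sum>a\<in>?U. \<Sum>b\<in>?U. n * c a b)"
    by (simp only: sum_distrib_left)
  also have "\<dots> = (\<Sum>(x, i)\<in>?U. \<Sum>(y, j)\<in>?U. n ^ card (pairs N) * (of_bool (i \<noteq> j) * codeg G x y))"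
    by (auto intro!: sum.cong c)
  also have "\<dots> = (\<Sum>x\<in>?V. \<Sum>i<N. \<Sum>y\<in>?V. \<Sum>j<N. n ^ card (pairs N) * (of_bool (i \<noteq> j) * codeg G x y))"
    by (simp only: sum.cartesian_product[symmetric])
  also have "\<dots> = (\<Sum>x\<in>?V. \<Sum>i<N. \<Sum>y\<in>?V. n ^ card (pairs N) * codeg G x y * (real N - 1))"
  proof (intro sum.cong refl)
    fix x y i
    assume "i \<in> {..<N}"
    have "(\<Sum>j<N. of_bool (i \<noteq> j)) = real (card ({..<N} - {i}))"
      by (simp add: sum_of_bool_eq) (rule arg_cong[of _ _ card], auto)
    also have "\<dots> = real N - 1"
      using \<open>i \<in> {..<N}\<close> by (simp add: of_nat_diff)
    finally show "(\<Sum>j<N. n ^ card (pairs N) * (of_bool (i \<noteq> j) * codeg G x y))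
        = n ^ card (pairs N) * codeg G x y * (real N - 1)"
      by (simp only: sum_distrib_left[symmetric] sum_distrib_right[symmetric] mult_ac)
  qed
  also have "\<dots> = n ^ card (pairs N) * (real N * (real N - 1) * (\<Sum>x\<in>?V. \<Sum>y\<in>?V. codeg G x y))"
    by (simp add: sum_distrib_left mult_ac)
  finally show ?thesis .
qed

text \<open>Sidorenko's inequality for \<open>H\<close> is applied to every blow-up and averaged
  over \<phi>; convexity replaces the mean of the powers of the density by the power of its mean.
  Here \<open>p\<close> is the probability that a random level map is injective.\<close>

lemma sidorenko_blowup_bound:
  fixes G :: "'b ugraph" and H :: "'a ugraph" and N :: nat
  assumes H: "finite_simple_graph H" "sidorenko H" and G: "finite_simple_graph G" "verts G \<noteq> {}"
    and N: "N > 0"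
  defines "n \<equiv> real (card (verts G))" and "v \<equiv> card (verts H)" and "m \<equiv> card (edges H)"
  defines "p \<equiv> real (card {g \<in> verts H \<rightarrow>\<^sub>E {..<N}. inj_on g (verts H)}) / real N ^ v"
  shows "n ^ (v + m) * ((real N - 1) / real N * (\<Sum>x\<in>verts G. \<Sum>y\<in>verts G. codeg G x y) / n ^ 3) ^ m
    \<le> p * (\<Sum>f\<in>verts H \<rightarrow>\<^sub>E verts G. \<Prod>e\<in>edges H. real (card (common_nbrs G (f ` e)))) +
      (1 - p) * n ^ (v + m)"
proof -
  let ?\<Phi> = "pairs N \<rightarrow>\<^sub>E verts G"
  let ?T = "\<Sum>x\<in>verts G. \<Sum>y\<in>verts G. codeg G x y"
  let ?S = "\<Sum>f\<in>verts H \<rightarrow>\<^sub>E verts G. \<Prod>e\<in>edges H. real (card (common_nbrs G (f ` e)))"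
  define M where "M = n ^ card (pairs N)"
  define t where "t \<phi> = 2 * real (card (edges (blowup G N \<phi>))) / (n * real N)\<^sup>2" for \<phi>
  \<comment> \<open>\<open>a\<close> is the mean of the densities \<open>t\<close>: the average of
    \<open>codeg G x y / n\<close> over all ordered pairs, times the fraction of ordered pairs of
    levels that are different.\<close>
  define a where "a = (real N - 1) / real N * ?T / n ^ 3"
  have finV: "finite (verts G)"
    using G by (simp add: finite_simple_graph_def)
  have n: "0 < n"
    using finV G(2) by (simp add: n_def card_gt_0_iff)
  have M: "0 < M" "real (card ?\<Phi>) = M"
    using n finite_pairs by (simp_all add: M_def n_def card_funcsetE)
  have fin: "finite ?\<Phi>"
    using finV finite_pairs by (simp add: finite_PiE)
  have "n * (\<Sum>\<phi>\<in>?\<Phi>. t \<phi>) = M * (real N * (real N - 1) * ?T) / (n * real N)\<^sup>2"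
    using sum_card_edges_blowup[OF G(1), of N] unfolding t_def M_def n_def
    by (simp only: sum_divide_distrib[symmetric] times_divide_eq_right)
  also have "\<dots> = n * (M * a)"
    using n N by (simp add: a_def field_simps power2_eq_square power3_eq_cube)
  finally have sum_t: "(\<Sum>\<phi>\<in>?\<Phi>. t \<phi>) = M * a"
    using n by simp
  have "(M * a) ^ m * M \<le> M ^ m * (\<Sum>\<phi>\<in>?\<Phi>. t \<phi> ^ m)"
    using power_mean[OF fin, of t m] unfolding M(2) sum_t by (simp add: t_def)
  then have "M * a ^ m \<le> (\<Sum>\<phi>\<in>?\<Phi>. t \<phi> ^ m)"
    using M(1) by (simp add: power_mult_distrib mult_ac)
  then have "(n * real N) ^ v * (M * a ^ m) * n ^ m
      \<le> (n * real N) ^ v * (\<Sum>\<phi>\<in>?\<Phi>. t \<phi> ^ m) * n ^ m"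
    using n by (intro mult_right_mono mult_left_mono) auto
  also have "\<dots> \<le> (\<Sum>\<phi>\<in>?\<Phi>. real (card (Hom H (blowup G N \<phi>)))) * n ^ m"
  proof (rule mult_right_mono)
    have "(n * real N) ^ v * t \<phi> ^ m \<le> real (card (Hom H (blowup G N \<phi>)))" for \<phi>
    proof -
      have "real (card (verts (blowup G N \<phi>))) = n * real N"
        by (simp add: blowup_def n_def card_cartesian_product)
      then show ?thesis
        using sidorenko_any_type[OF H finite_simple_graph_blowup[OF G(1)], of N \<phi>]
        by (simp add: sidorenko_ineq_def t_def v_def m_def)
    qed
    then show "(n * real N) ^ v * (\<Sum>\<phi>\<in>?\<Phi>. t \<phi> ^ m) \<le> (\<Sum>\<phi>\<in>?\<Phi>. real (card (Hom H (blowup G N \<phi>))))"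
      unfolding sum_distrib_left by (rule sum_mono)
  qed (use n in simp)
  \<comment> \<open>As \<open>N\<close> is positive, \<open>p * real N ^ v\<close> is the number of
    injective level maps.\<close>
  also have "\<dots> \<le> M * (p * real N ^ v * ?S + (real N ^ v - p * real N ^ v) * n ^ (v + m))"
    using sum_card_Hom_blowup_le[OF H(1) G(1), of N] N by (simp add: n_def M_def v_def m_def p_def)
  finally have "(M * real N ^ v) * (n ^ (v + m) * a ^ m)
      \<le> (M * real N ^ v) * (p * ?S + (1 - p) * n ^ (v + m))"
    by (simp add: power_mult_distrib power_add algebra_simps)
  then show ?thesis
    using M(1) N by (simp add: a_def)
qed

section \<open>The limit of infinitely many levels\<close>

lemma tendsto_injective_fraction:
  assumes A: "finite A"
  shows "(\<lambda>N. real (card {g \<in> A \<rightarrow>\<^sub>E {..<N}. inj_on g A}) / real N ^ card A) \<longlonglongrightarrow> 1"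
proof -
  have "(\<lambda>N. real (N - i) / real N) \<longlonglongrightarrow> 1" for i
  proof (rule Lim_transform_eventually)
    have "(\<lambda>N. 1 - real i / real N) \<longlonglongrightarrow> 1 - 0"
      by (intro tendsto_diff tendsto_const lim_const_over_n)
    then show "(\<lambda>N. 1 - real i / real N) \<longlonglongrightarrow> 1"
      by simp
    show "\<forall>\<^sub>F N in sequentially. 1 - real i / real N = real (N - i) / real N"
      \<comment> \<open>Truncated subtraction agrees with the real one for large \<open>N\<close>,
        and \<open>N\<close> is then nonzero as well.\<close>
      using eventually_gt_at_top[of i]
      by eventually_elim (simp add: of_nat_diff diff_divide_distrib)
  qed
  then have "(\<lambda>N. \<Prod>i = 0..<card A. real (N - i) / real N) \<longlonglongrightarrow> (\<Prod>i = 0..<card A. 1)"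
    by (intro tendsto_prod)
  \<comment> \<open>The injective maps are counted by a falling factorial, whose number of factors
    does not depend on \<open>N\<close>.\<close>
  moreover have "real (card {g \<in> A \<rightarrow>\<^sub>E {..<N}. inj_on g A}) / real N ^ card A
      = (\<Prod>i = 0..<card A. real (N - i) / real N)" for N
    using card_inj_on_subset_funcset[OF A, of "{..<N}" A] by (simp add: prod_dividef)
  ultimately show ?thesis
    by simp
qed

text \<open>The limit of the blow-up bounds is Sidorenko's inequality for \<open>H\<close> with edge
  weights \<open>codeg G x y / n\<close>. The average weight is at least the square of the edge
  density of \<open>G\<close>, which doubles the exponent as the subdivision requires.\<close>

lemma sidorenko_subdivision:
  fixes H :: "'a ugraph"
  assumes H: "finite_simple_graph H" "sidorenko H"
  shows "sidorenko (subdivision H)"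
proof (rule sidorenko_subdivisionI[OF H(1)])
  fix G :: "nat ugraph"
  assume G: "finite_simple_graph G" "verts G \<noteq> {}"
  let ?n = "real (card (verts G))" and ?v = "card (verts H)" and ?m = "card (edges H)"
  let ?S = "\<Sum>f\<in>verts H \<rightarrow>\<^sub>E verts G. \<Prod>e\<in>edges H. real (card (common_nbrs G (f ` e)))"
  let ?T = "\<Sum>x\<in>verts G. \<Sum>y\<in>verts G. codeg G x y"
  let ?p = "\<lambda>N. real (card {g \<in> verts H \<rightarrow>\<^sub>E {..<N}. inj_on g (verts H)}) / real N ^ ?v"
  have n: "0 < ?n"
    using G by (simp add: finite_simple_graph_def card_gt_0_iff)
  have p: "?p \<longlonglongrightarrow> 1"
    using H(1) by (intro tendsto_injective_fraction) (simp add: finite_simple_graph_def)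
  have q: "(\<lambda>N. (real N - 1) / real N) \<longlonglongrightarrow> 1"
  proof (rule Lim_transform_eventually)
    have "(\<lambda>N. 1 - 1 / real N) \<longlonglongrightarrow> 1 - 0"
      by (intro tendsto_diff tendsto_const lim_const_over_n)
    then show "(\<lambda>N. 1 - 1 / real N) \<longlonglongrightarrow> 1"
      by simp
    show "\<forall>\<^sub>F N in sequentially. 1 - 1 / real N = (real N - 1) / real N"
      using eventually_gt_at_top[of 0] by eventually_elim (simp add: diff_divide_distrib)
  qed
  \<comment> \<open>The coefficient \<open>1 - 1\<close> is the limit of the probability of a
    non-injective level map, so the error term disappears.\<close>
  have lim: "?n ^ (?v + ?m) * (1 * ?T / ?n ^ 3) ^ ?m \<le> 1 * ?S + (1 - 1) * ?n ^ (?v + ?m)"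
  proof (rule tendsto_le[OF sequentially_bot])
    show "(\<lambda>N. ?n ^ (?v + ?m) * ((real N - 1) / real N * ?T / ?n ^ 3) ^ ?m)
        \<longlonglongrightarrow> ?n ^ (?v + ?m) * (1 * ?T / ?n ^ 3) ^ ?m"
      using n by (intro tendsto_intros q) simp
    show "(\<lambda>N. ?p N * ?S + (1 - ?p N) * ?n ^ (?v + ?m)) \<longlonglongrightarrow> 1 * ?S + (1 - 1) * ?n ^ (?v + ?m)"
      by (intro tendsto_intros p)
    show "\<forall>\<^sub>F N in sequentially.
        ?n ^ (?v + ?m) * ((real N - 1) / real N * ?T / ?n ^ 3) ^ ?m
        \<le> ?p N * ?S + (1 - ?p N) * ?n ^ (?v + ?m)"
      using eventually_gt_at_top[of 0] by eventually_elim (rule sidorenko_blowup_bound[OF H G])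
  qed
  \<comment> \<open>The codegree form with unit weights.\<close>
  have "(2 * real (card (edges G)))\<^sup>2 \<le> ?n * ?T"
    using codeg_form_ge[OF G(1), of "\<lambda>_. 1"] by (simp add: sum_deg[OF G(1)])
  then have "(2 * real (card (edges G)) / ?n\<^sup>2)\<^sup>2 \<le> ?T / ?n ^ 3"
    using n by (simp add: power_divide field_simps power2_eq_square power3_eq_cube)
  then have "((2 * real (card (edges G)) / ?n\<^sup>2)\<^sup>2) ^ ?m \<le> (?T / ?n ^ 3) ^ ?m"
    by (rule power_mono) simp
  then have "?n ^ (?v + ?m) * ((2 * real (card (edges G)) / ?n\<^sup>2)\<^sup>2) ^ ?m
      \<le> ?n ^ (?v + ?m) * (?T / ?n ^ 3) ^ ?m"
    by (rule mult_left_mono) simp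
  also have "\<dots> \<le> ?S"
    using lim by (simp only: mult_1 diff_self mult_zero_left add_0_right)
  finally show "?n ^ (?v + ?m) * (2 * real (card (edges G)) / ?n\<^sup>2) ^ (2 * ?m) \<le> ?S"
    by (simp only: power_mult)
qed

theorem theorem1p3:
  "(\<forall>k::nat. k \<ge> 1 \<longrightarrow> sidorenko (subdivision (complete_graph k))) \<and>
   (\<forall>H :: 'a ugraph. finite_simple_graph H \<longrightarrow> sidorenko H \<longrightarrow> sidorenko (subdivision H))"
  using sidorenko_subdivision_complete_graph sidorenko_subdivision by blast

end
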